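(* Let $\mathcal{T}:\mathcal{V}\to L^2(\mathcal{Z})$ be linear, compact and injective, let $J:\mathcal{V}\to\mathbb{R}_+$ be convex, lower semicontinuous and Fréchet differentiable, and let $\varphi^\dagger\in\mathcal{V}$, $\delta>0$, $f^\delta\in L^2(\mathcal{Z})$ with $\|\mathcal{T}\varphi^\dagger-f^\delta\|_{L^2(\mathcal{Z})}\le\delta$. Let $\Psi$ be a concave index function and $\tilde\gamma\in(0,1]$, and let $\overline{\tau}\ge1$ be fixed. Suppose the regularization parameter is chosen as $$\alpha=\alpha(\delta,f^\delta):=\Phi(\delta,f^\delta)=\frac{\delta^2}{2\Psi(\delta)},$$ that $\varphi_\alpha\in\arg\min_{\varphi\in\mathcal{V}}\{\frac12\|\mathcal{T}\varphi-f^\delta\|_{L^2(\mathcal{Z})}^2+\alpha J(\varphi)\}$, that $\alpha\in\overline{S}$, i.e. $\|\mathcal{T}\varphi_\alpha-f^\delta\|_{L^2(\mathcal{Z})}\le\overline{\tau}\delta$, and that $\varphi=\varphi_\alpha$ satisfies the variational inequality $$\tilde\gamma\|\varphi-\varphi^\dagger\|_{L^2(\Omega)}^2\le J(\varphi)-J(\varphi^\dagger)+\Psi\big(\|\mathcal{T}\varphi-\mathcal{T}\varphi^\dagger\|_{L^2(\mathcal{Z})}\big).$$ Then $$\|\mathcal{T}\varphi_{\alpha(\delta,f^\delta)}-\mathcal{T}\varphi^\dagger\|_{L^2(\mathcal{Z})}\ \le\ \delta\sqrt{6+2\overline{\tau}}.$$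
   Context: $\mathcal{V}$ is a Banach space of functions on a compact domain $\Omega$ (contained in $L^2(\Omega)$, so that the norms written make sense), and $\mathcal{Z}\subset\mathbb{R}_+$ is a compact domain. An index function is a continuous, monotonically increasing function $\Psi:[0,\infty)\to[0,\infty)$ with $\Psi(0)=0$. $\varphi^\dagger$ is the true solution, $f^\dagger=\mathcal{T}\varphi^\dagger$ the exact data, and $f^\delta$ the noisy data. *)

theory Defs
  imports "HOL-Analysis.Analysis"
begin

text \<open>
  Elements of a real \<open>L\<^sup>2\<close> space are represented by square-integrable functions; equality in
  \<open>L\<^sup>2\<close> is equality almost everywhere. The space \<open>L\<^sup>2(S)\<close> is obtained with
  \<open>M = lebesgue_on S\<close>.
\<close>

definition L2_space :: "'a measure \<Rightarrow> ('a \<Rightarrow> real) set" where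
  "L2_space M = {f \<in> borel_measurable M. integrable M (\<lambda>x. (f x)\<^sup>2)}"

definition L2_norm :: "'a measure \<Rightarrow> ('a \<Rightarrow> real) \<Rightarrow> real" where
  "L2_norm M f = sqrt (\<integral>x. (f x)\<^sup>2 \<partial>M)"

text \<open>
  Operators into \<open>L\<^sup>2\<close> choose a representative of each value, so linearity and injectivity
  are understood modulo null sets.
\<close>

definition L2_linear :: "'a measure \<Rightarrow> ('v::real_vector \<Rightarrow> 'a \<Rightarrow> real) \<Rightarrow> bool" where
  "L2_linear M T \<longleftrightarrow>
     (\<forall>v. T v \<in> L2_space M) \<and>
     (\<forall>v w. AE x in M. T (v + w) x = T v x + T w x) \<and>
     (\<forall>c v. AE x in M. T (c *\<^sub>R v) x = c * T v x)"

definition L2_inj :: "'a measure \<Rightarrow> ('v \<Rightarrow> 'a \<Rightarrow> real) \<Rightarrow> bool" where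
  "L2_inj M T \<longleftrightarrow> (\<forall>v w. (AE x in M. T v x = T w x) \<longrightarrow> v = w)"

definition L2_compact :: "'a measure \<Rightarrow> ('v::real_normed_vector \<Rightarrow> 'a \<Rightarrow> real) \<Rightarrow> bool" where
  "L2_compact M T \<longleftrightarrow>
     (\<forall>v :: nat \<Rightarrow> 'v. bounded (range v) \<longrightarrow>
        (\<exists>r g. strict_mono r \<and> g \<in> L2_space M \<and>
           (\<lambda>n. L2_norm M (\<lambda>x. T (v (r n)) x - g x)) \<longlonglongrightarrow> 0))"

definition lower_semicont :: "('v::topological_space \<Rightarrow> real) \<Rightarrow> bool" where
  "lower_semicont J \<longleftrightarrow> (\<forall>v. \<forall>c < J v. \<forall>\<^sub>F w in nhds v. c < J w)"

text \<open>An index function lives on the half-line; its values at negative arguments are irrelevant.\<close>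

definition index_function :: "(real \<Rightarrow> real) \<Rightarrow> bool" where
  "index_function \<Psi> \<longleftrightarrow>
     \<Psi> ` {0..} \<subseteq> {0..} \<and> continuous_on {0..} \<Psi> \<and> mono_on {0..} \<Psi> \<and> \<Psi> 0 = 0"

definition tikhonov ::
  "'a measure \<Rightarrow> ('v \<Rightarrow> 'a \<Rightarrow> real) \<Rightarrow> ('v \<Rightarrow> real) \<Rightarrow> ('a \<Rightarrow> real) \<Rightarrow> real \<Rightarrow> 'v \<Rightarrow> real" where
  "tikhonov M T J f \<alpha> v = 1 / 2 * (L2_norm M (\<lambda>x. T v x - f x))\<^sup>2 + \<alpha> * J v"

end

theory Submission
  imports Defs
begin

text \<open>
  Write \<open>d = \<parallel>T \<phi>\<^sub>\<alpha> - T \<phi>dag\<parallel>\<close>. Comparing the Tikhonov functional at \<open>\<phi>\<^sub>\<alpha>\<close> and \<open>\<phi>dag\<close> and using the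
  variational inequality gives \<open>\<parallel>T \<phi>\<^sub>\<alpha> - f\<delta>\<parallel>\<^sup>2 \<le> \<delta>\<^sup>2 + 2 \<alpha> \<Psi> d\<close>. For \<open>d > \<delta>\<close> concavity yields
  \<open>\<Psi> d \<le> (d / \<delta>) \<Psi> \<delta>\<close>, so the choice of \<open>\<alpha>\<close> bounds the last term by \<open>\<delta> d\<close>. Hence
  \<open>d\<^sup>2 \<le> 2 \<parallel>T \<phi>\<^sub>\<alpha> - f\<delta>\<parallel>\<^sup>2 + 2 \<delta>\<^sup>2 \<le> 4 \<delta>\<^sup>2 + 2 \<delta> d\<close>, and \<open>d \<le> (\<tau> + 1) \<delta>\<close> finishes the estimate.
\<close>

lemma L2_spaceD:
  assumes "f \<in> L2_space M"
  shows "f \<in> borel_measurable M" and "integrable M (\<lambda>x. (f x)\<^sup>2)"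
  using assms by (auto simp: L2_space_def)

lemma L2_norm_nonneg: "0 \<le> L2_norm M f"
  by (simp add: L2_norm_def)

lemma L2_norm_power2: "(L2_norm M f)\<^sup>2 = (\<integral>x. (f x)\<^sup>2 \<partial>M)"
  by (simp add: L2_norm_def)

text \<open>The gap between the two sides is the square of \<open>t * a + b\<close> divided by
  \<open>t\<close>. The weight stays free: \<open>t = 1\<close> gives the factors 2, and a tuned
  \<open>t\<close> gives the triangle inequality.\<close>

lemma power2_diff_le_weighted:
  fixes a b t :: real
  assumes "0 < t"
  shows "(a - b)\<^sup>2 \<le> (1 + t) * a\<^sup>2 + (1 + 1 / t) * b\<^sup>2"
proof -
  have "(1 + t) * a\<^sup>2 + (1 + 1 / t) * b\<^sup>2 - (a - b)\<^sup>2 = (t * a + b)\<^sup>2 / t"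
    using assms by (simp add: field_simps power2_eq_square)
  moreover have "0 \<le> (t * a + b)\<^sup>2 / t"
    using assms by simp
  ultimately show ?thesis by linarith
qed

lemma L2_space_diff:
  assumes "f \<in> L2_space M" "g \<in> L2_space M"
  shows "(\<lambda>x. f x - g x) \<in> L2_space M"
proof -
  note [measurable] = L2_spaceD(1)[OF assms(1)] L2_spaceD(1)[OF assms(2)]
  have "integrable M (\<lambda>x. (f x - g x)\<^sup>2)"
  proof (rule Bochner_Integration.integrable_bound)
    show "integrable M (\<lambda>x. 2 * (f x)\<^sup>2 + 2 * (g x)\<^sup>2)"
      using assms[THEN L2_spaceD(2)] by simp
    show "AE x in M. norm ((f x - g x)\<^sup>2) \<le> norm (2 * (f x)\<^sup>2 + 2 * (g x)\<^sup>2)"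
      using power2_diff_le_weighted[of 1] by simp
  qed measurable
  then show ?thesis by (simp add: L2_space_def)
qed

lemma L2_norm_diff_le_weighted:
  assumes "f \<in> L2_space M" "g \<in> L2_space M" "0 < t"
  shows "(L2_norm M (\<lambda>x. f x - g x))\<^sup>2 \<le> (1 + t) * (L2_norm M f)\<^sup>2 + (1 + 1 / t) * (L2_norm M g)\<^sup>2"
proof -
  note int = assms(1,2)[THEN L2_spaceD(2)] L2_space_diff[OF assms(1,2), THEN L2_spaceD(2)]
  have "(\<integral>x. (f x - g x)\<^sup>2 \<partial>M) \<le> (\<integral>x. (1 + t) * (f x)\<^sup>2 + (1 + 1 / t) * (g x)\<^sup>2 \<partial>M)"
    using int by (intro integral_mono power2_diff_le_weighted assms) auto
  also have "\<dots> = (1 + t) * (\<integral>x. (f x)\<^sup>2 \<partial>M) + (1 + 1 / t) * (\<integral>x. (g x)\<^sup>2 \<partial>M)"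
    using int by simp
  finally show ?thesis by (simp add: L2_norm_power2)
qed

text \<open>The weight \<open>t = B / A\<close> collapses the weighted bound to the square of
  \<open>A + B\<close>, so Cauchy-Schwarz is not invoked. Positive bounds in place of the norms
  themselves keep this weight meaningful when a norm vanishes.\<close>

lemma L2_norm_diff_le:
  assumes "f \<in> L2_space M" "g \<in> L2_space M"
    and "L2_norm M f \<le> A" "L2_norm M g \<le> B" "0 < A" "0 < B"
  shows "L2_norm M (\<lambda>x. f x - g x) \<le> A + B"
proof (rule power2_le_imp_le)
  have "(L2_norm M (\<lambda>x. f x - g x))\<^sup>2
      \<le> (1 + B / A) * (L2_norm M f)\<^sup>2 + (1 + 1 / (B / A)) * (L2_norm M g)\<^sup>2"
    using assms by (intro L2_norm_diff_le_weighted) auto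
  also have "\<dots> \<le> (1 + B / A) * A\<^sup>2 + (1 + 1 / (B / A)) * B\<^sup>2"
    using assms by (intro add_mono mult_left_mono power_mono L2_norm_nonneg) auto
  also have "\<dots> = (A + B)\<^sup>2"
    using assms by (simp add: field_simps power2_eq_square)
  finally show "(L2_norm M (\<lambda>x. f x - g x))\<^sup>2 \<le> (A + B)\<^sup>2" .
qed (use assms in simp)

text \<open>The point \<open>s\<close> is the convex combination of 0 and \<open>t\<close> with
  weight \<open>s / t\<close> on \<open>t\<close>, and the term at 0 vanishes since
  \<open>\<Psi> 0 = 0\<close>.\<close>

lemma concave_index_function_le:
  assumes "index_function \<Psi>" "concave_on {0..} \<Psi>" "0 < s" "s \<le> t"
  shows "\<Psi> t \<le> t / s * \<Psi> s"
proof -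
  have "(1 - s / t) * \<Psi> 0 + s / t * \<Psi> t \<le> \<Psi> ((1 - s / t) *\<^sub>R 0 + (s / t) *\<^sub>R t)"
    using assms by (intro concave_onD[OF assms(2)]) auto
  then have "s / t * \<Psi> t \<le> \<Psi> s"
    using assms by (simp add: index_function_def)
  then show ?thesis
    using assms by (simp add: field_simps)
qed

theorem corollary3p5:
  fixes \<Omega> :: "'a::euclidean_space set" and Z :: "real set"
    and emb :: "'v::banach \<Rightarrow> 'a \<Rightarrow> real"
    and T :: "'v \<Rightarrow> real \<Rightarrow> real"
    and J :: "'v \<Rightarrow> real"
    and \<phi>dag \<phi>\<^sub>\<alpha> :: 'v
    and f\<delta> :: "real \<Rightarrow> real"
    and \<Psi> :: "real \<Rightarrow> real"
    and \<delta> \<gamma> \<tau> \<alpha> :: real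
  assumes "compact \<Omega>"
    and "compact Z" and "Z \<subseteq> {0..}"
    and "L2_linear (lebesgue_on \<Omega>) emb" and "L2_inj (lebesgue_on \<Omega>) emb"
    and "L2_linear (lebesgue_on Z) T" and "L2_compact (lebesgue_on Z) T"
    and "L2_inj (lebesgue_on Z) T"
    and "\<forall>v. 0 \<le> J v" and "convex_on UNIV J" and "lower_semicont J"
    and "\<forall>v. J differentiable (at v)"
    and "\<delta> > 0" and "f\<delta> \<in> L2_space (lebesgue_on Z)"
    and "L2_norm (lebesgue_on Z) (\<lambda>z. T \<phi>dag z - f\<delta> z) \<le> \<delta>"
    and "index_function \<Psi>" and "concave_on {0..} \<Psi>"
    and "0 < \<gamma>" and "\<gamma> \<le> 1" and "1 \<le> \<tau>"
    and "\<alpha> = \<delta>\<^sup>2 / (2 * \<Psi> \<delta>)"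
    and "is_arg_min (tikhonov (lebesgue_on Z) T J f\<delta> \<alpha>) (\<lambda>v. v \<in> UNIV) \<phi>\<^sub>\<alpha>"
    and "L2_norm (lebesgue_on Z) (\<lambda>z. T \<phi>\<^sub>\<alpha> z - f\<delta> z) \<le> \<tau> * \<delta>"
    and "\<gamma> * (L2_norm (lebesgue_on \<Omega>) (\<lambda>x. emb \<phi>\<^sub>\<alpha> x - emb \<phi>dag x))\<^sup>2
           \<le> J \<phi>\<^sub>\<alpha> - J \<phi>dag + \<Psi> (L2_norm (lebesgue_on Z) (\<lambda>z. T \<phi>\<^sub>\<alpha> z - T \<phi>dag z))"
  shows "L2_norm (lebesgue_on Z) (\<lambda>z. T \<phi>\<^sub>\<alpha> z - T \<phi>dag z) \<le> \<delta> * sqrt (6 + 2 * \<tau>)"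
proof -
  let ?M = "lebesgue_on Z"
  define d where "d = L2_norm ?M (\<lambda>z. T \<phi>\<^sub>\<alpha> z - T \<phi>dag z)"
  define r where "r = L2_norm ?M (\<lambda>z. T \<phi>\<^sub>\<alpha> z - f\<delta> z)"
  define e where "e = L2_norm ?M (\<lambda>z. T \<phi>dag z - f\<delta> z)"
  note \<delta> = \<open>\<delta> > 0\<close> and \<tau> = \<open>1 \<le> \<tau>\<close> and \<Psi> = \<open>index_function \<Psi>\<close> \<open>concave_on {0..} \<Psi>\<close>
  have e: "0 \<le> e" "e \<le> \<delta>" and r: "r \<le> \<tau> * \<delta>" and d: "0 \<le> d"
    using assms by (auto simp: d_def e_def r_def L2_norm_nonneg)
  have T: "T v \<in> L2_space ?M" for v
    using \<open>L2_linear ?M T\<close> by (simp add: L2_linear_def)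
  note res = L2_space_diff[OF T \<open>f\<delta> \<in> L2_space ?M\<close>]
  \<comment> \<open>The data \<open>f\<delta>\<close> cancel in the difference of the two residuals,
    which leaves \<open>T \<phi>\<^sub>\<alpha> - T \<phi>dag\<close>.\<close>
  have d_sq: "d\<^sup>2 \<le> 2 * r\<^sup>2 + 2 * e\<^sup>2"
    using L2_norm_diff_le_weighted[OF res[of \<phi>\<^sub>\<alpha>] res[of \<phi>dag], of 1] by (simp add: d_def r_def e_def)
  have d_le: "d \<le> \<tau> * \<delta> + \<delta>"
    using L2_norm_diff_le[OF res[of \<phi>\<^sub>\<alpha>] res[of \<phi>dag], of "\<tau> * \<delta>" \<delta>] r e \<delta> \<tau>
    by (simp add: d_def r_def e_def)
  have e_sq: "e\<^sup>2 \<le> \<delta>\<^sup>2"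
    using e by (intro power_mono)
  have \<Psi>\<delta>: "0 \<le> \<Psi> \<delta>"
    using \<Psi>(1) \<delta> by (simp add: index_function_def image_subset_iff)
  then have \<alpha>: "0 \<le> \<alpha>"
    using assms(21) by simp
  \<comment> \<open>an inequality only, because \<open>\<alpha> = 0\<close> when \<open>\<Psi> \<delta> = 0\<close>\<close>
  have \<alpha>\<Psi>: "\<alpha> * \<Psi> \<delta> \<le> \<delta>\<^sup>2 / 2"
    using assms(21) by (cases "\<Psi> \<delta> = 0") auto
  have "r\<^sup>2 / 2 + \<alpha> * J \<phi>\<^sub>\<alpha> \<le> e\<^sup>2 / 2 + \<alpha> * J \<phi>dag"
    using \<open>is_arg_min _ _ \<phi>\<^sub>\<alpha>\<close> by (auto simp: is_arg_min_linorder tikhonov_def r_def e_def)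
  \<comment> \<open>The left side of the variational inequality is nonnegative and is
    dropped.\<close>
  moreover have "J \<phi>dag - J \<phi>\<^sub>\<alpha> \<le> \<Psi> d"
    using assms(24) mult_nonneg_nonneg[OF less_imp_le[OF \<open>0 < \<gamma>\<close>] zero_le_power2]
    unfolding d_def by (smt (verit))
  then have "\<alpha> * (J \<phi>dag - J \<phi>\<^sub>\<alpha>) \<le> \<alpha> * \<Psi> d"
    using \<alpha> by (rule mult_left_mono)
  ultimately have r_sq: "r\<^sup>2 \<le> e\<^sup>2 + 2 * (\<alpha> * \<Psi> d)"
    by (simp add: algebra_simps)
  have "d\<^sup>2 \<le> (6 + 2 * \<tau>) * \<delta>\<^sup>2"
  \<comment> \<open>Concavity compares \<Psi> at \<open>d\<close> and \<delta> in the needed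
    direction only when \<open>d\<close> is at least \<delta>; below that the claim is immediate
    from \<open>1 \<le> 6 + 2 * \<tau>\<close>.\<close>
  proof (cases "d \<le> \<delta>")
    case True
    then have "d\<^sup>2 \<le> 1 * \<delta>\<^sup>2"
      using d by (simp add: power_mono)
    also have "\<dots> \<le> (6 + 2 * \<tau>) * \<delta>\<^sup>2"
      using \<tau> by (intro mult_right_mono) auto
    finally show ?thesis .
  next
    case False
    then have "\<alpha> * \<Psi> d \<le> \<alpha> * (d / \<delta> * \<Psi> \<delta>)"
      using \<alpha> \<delta> by (intro mult_left_mono concave_index_function_le \<Psi>) auto
    also have "\<dots> = d / \<delta> * (\<alpha> * \<Psi> \<delta>)"
      by simp
    also have "\<dots> \<le> d / \<delta> * (\<delta>\<^sup>2 / 2)"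
      using \<alpha>\<Psi> d \<delta> by (intro mult_left_mono) auto
    also have "\<dots> = \<delta> * d / 2"
      using \<delta> by (simp add: power2_eq_square)
    finally have "d\<^sup>2 \<le> 4 * \<delta>\<^sup>2 + 2 * \<delta> * d"
      using d_sq r_sq e_sq by linarith
    \<comment> \<open>Inserting the crude bound only into the linear term, rather than solving the
      quadratic inequality for \<open>d\<close>, produces the constant as 4 + 2 (\<tau> +
      1).\<close>
    also have "\<dots> \<le> 4 * \<delta>\<^sup>2 + 2 * \<delta> * (\<tau> * \<delta> + \<delta>)"
      using d_le \<delta> by simp
    also have "\<dots> = (6 + 2 * \<tau>) * \<delta>\<^sup>2"
      by (simp add: algebra_simps power2_eq_square)
    finally show ?thesis .
  qed
  then have "sqrt (d\<^sup>2) \<le> sqrt ((6 + 2 * \<tau>) * \<delta>\<^sup>2)"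
    by (rule real_sqrt_le_mono)
  then show ?thesis
    using d \<delta> by (simp add: real_sqrt_mult d_def mult.commute)
qed

end
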